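(* In the categorical label-shift setup, assume moreover that $T_g$ has full column rank and that $\theta_{\max}\ge\|\theta\|$. Let $\delta\in(0,1)$ and suppose $n\ge\frac{32}{\alpha}\|T_g^\dagger\|^2 d\log\frac{6(d+k)}{\delta}$. Then with probability at least $1-\delta$ the estimator $\widehat\theta=\widehat T_g^\dagger(\widehat q_g-\widehat p_g)$ satisfies $$\|\widehat\theta-\theta\|\le 2\|T_g^\dagger\|\Big(\sqrt{\frac{d}{\alpha n}\log\frac{6d}{\delta}}+\sqrt{\frac{d}{m}\log\frac{6d}{\delta}}+2\theta_{\max}\sqrt{\frac{2d}{\alpha n}\log\frac{6(d+k)}{\delta}}\Big).$$
   Context: Categorical label-shift setup: $\mathcal X$ is a measurable space and $\mathcal Y=\{1,\dots,k\}$. $\mathbb P$ (source) and $\mathbb Q$ (target) are probability measures on $\mathcal X\times\mathcal Y$ with $\mathbb P(Y=j)>0$ for all $j$, and label shift holds: for each $j$, the conditional distribution of $X$ given $Y=j$ is the same under $\mathbb P$ and $\mathbb Q$. Importance weights: $\omega\in\mathbb R^k$, $\omega_j=\mathbb Q(Y=j)/\mathbb P(Y=j)$, and $\theta:=\omega-\vec 1$, where $\vec 1$ is the all-ones vector. Fix a measurable $g:\mathcal X\to[-1,1]^d$. Define $p_g=\mathbb E_{\mathbb P}[g(X)]\in\mathbb R^d$, $q_g=\mathbb E_{\mathbb Q}[g(X)]\in\mathbb R^d$, and $T_g\in\mathbb R^{d\times k}$ by $(T_g)_{ij}=\mathbb E_{\mathbb P}[g_i(X)\mathbf 1\{Y=j\}]$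 (so that $q_g-p_g=T_g\theta$). Data: $\alpha n$ (a positive integer, $\alpha\in(0,1]$) i.i.d. samples $(x_i,y_i)$ from $\mathbb P$, and, independently, $m$ i.i.d. samples $x'_j$ from the $\mathcal X$-marginal of $\mathbb Q$. Estimates: $\widehat p_g=\frac{1}{\alpha n}\sum_{i}g(x_i)$, $\widehat q_g=\frac1m\sum_j g(x'_j)$, $\widehat T_g=\frac{1}{\alpha n}\sum_i g(x_i)e_{y_i}^\top$, where $e_l\in\mathbb R^k$ is the $l$-th standard basis vector. Vector norms are Euclidean, matrix norms spectral; $\log$ is the natural logarithm. $T^\dagger$ is the Moore–Penrose pseudoinverse, and $\|T_g^\dagger\|$ is the inverse of the smallest singular value of $T_g$. *)

theory Defs
  imports "HOL-Probability.Probability"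
begin

definition pinv :: "real^'n^'m \<Rightarrow> real^'m^'n" where
  "pinv A = (THE X. A ** X ** A = A \<and> X ** A ** X = X \<and>
                    transpose (A ** X) = A ** X \<and> transpose (X ** A) = X ** A)"

definition spec_norm :: "real^'n^'m \<Rightarrow> real" where
  "spec_norm A = onorm (\<lambda>v. A *v v)"

definition label_prob :: "('x \<times> 'k) measure \<Rightarrow> 'k \<Rightarrow> real" where
  "label_prob P j = measure P {z \<in> space P. snd z = j}"

definition theta_vec :: "('x \<times> 'k::finite) measure \<Rightarrow> ('x \<times> 'k) measure \<Rightarrow> real^'k" where
  "theta_vec P Q = (\<chi> j. label_prob Q j / label_prob P j - 1)"

text \<open>Label shift: the conditional law of X given Y=j agrees under P and Q.\<close>
definition label_shift :: "'x measure \<Rightarrow> ('x \<times> 'k) measure \<Rightarrow> ('x \<times> 'k) measure \<Rightarrow> bool" where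
  "label_shift M P Q = (\<forall>A\<in>sets M. \<forall>j.
     measure Q (A \<times> {j}) = label_prob Q j * (measure P (A \<times> {j}) / label_prob P j))"

definition T_mat :: "('x \<times> 'k::finite) measure \<Rightarrow> ('x \<Rightarrow> real^'d) \<Rightarrow> real^'k^'d" where
  "T_mat P g = (\<chi> i j. integral\<^sup>L P (\<lambda>z. g (fst z) $ i * (if snd z = j then 1 else 0)))"

definition est_p :: "nat \<Rightarrow> ('x \<Rightarrow> real^'d) \<Rightarrow> (nat \<Rightarrow> 'x \<times> 'k) \<Rightarrow> real^'d" where
  "est_p N g xs = (1 / real N) *\<^sub>R (\<Sum>i<N. g (fst (xs i)))"

definition est_q :: "nat \<Rightarrow> ('x \<Rightarrow> real^'d) \<Rightarrow> (nat \<Rightarrow> 'x) \<Rightarrow> real^'d" where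
  "est_q m g xs' = (1 / real m) *\<^sub>R (\<Sum>j<m. g (xs' j))"

definition est_T :: "nat \<Rightarrow> ('x \<Rightarrow> real^'d) \<Rightarrow> (nat \<Rightarrow> 'x \<times> 'k::finite) \<Rightarrow> real^'k^'d" where
  "est_T N g xs = (\<chi> a b. (1 / real N) * (\<Sum>i<N. g (fst (xs i)) $ a * (if snd (xs i) = b then 1 else 0)))"

definition est_theta :: "nat \<Rightarrow> nat \<Rightarrow> ('x \<Rightarrow> real^'d) \<Rightarrow> (nat \<Rightarrow> 'x \<times> 'k::finite) \<Rightarrow> (nat \<Rightarrow> 'x) \<Rightarrow> real^'k" where
  "est_theta N m g xs xs' = pinv (est_T N g xs) *v (est_q m g xs' - est_p N g xs)"

definition sample_space :: "'x measure \<Rightarrow> nat \<Rightarrow> nat \<Rightarrow> ('x \<times> 'k) measure \<Rightarrow> ('x \<times> 'k) measure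
    \<Rightarrow> ((nat \<Rightarrow> 'x \<times> 'k) \<times> (nat \<Rightarrow> 'x)) measure" where
  "sample_space M N m P Q = (\<Pi>\<^sub>M i\<in>{..<N}. P) \<Otimes>\<^sub>M (\<Pi>\<^sub>M j\<in>{..<m}. distr Q M fst)"

end

theory Submission
  imports Defs
begin

text \<open>
  The estimation error is \<open>\<theta>\<^sub>e - \<theta> = T\<^sub>e\<^sup>\<dagger> ((q\<^sub>e - q) - (p\<^sub>e - p) - (T\<^sub>e - T) \<theta>)\<close>, where the subscript
  marks empirical quantities. Coordinatewise Hoeffding bounds on \<open>p\<^sub>e\<close> and \<open>q\<^sub>e\<close> lose a factor
  \<open>\<surd>2\<close> against the claimed rates, so the usual estimate \<open>\<parallel>T\<^sub>e\<^sup>\<dagger>\<parallel> \<le> 2 \<parallel>T\<^sup>\<dagger>\<parallel>\<close> does not suffice;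
  the loss is recovered by showing \<open>\<parallel>T\<^sub>e\<^sup>\<dagger>\<parallel> \<le> \<surd>2 \<parallel>T\<^sup>\<dagger>\<parallel>\<close>. For this, \<open>T\<^sub>e - T\<close> is controlled in Frobenius
  norm instead of by a matrix Hoeffding inequality: each summand \<open>g(x) e\<^sub>y\<^sup>T\<close> has Frobenius norm at most
  \<open>\<surd>d\<close>, so the norm of the deviation has expectation at most \<open>\<surd>(d/N)\<close> and bounded differences
  \<open>2\<surd>d/N\<close>. The bounded differences inequality then gives, with probability at least
  \<open>1 - \<delta>/3\<close>, a deviation below \<open>\<surd>(d/N) (1 + \<surd>(2 ln (3/\<delta>)))\<close>, which the sample size condition
  makes at most \<open>(1 - 1/\<surd>2) / \<parallel>T\<^sup>\<dagger>\<parallel>\<close>.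
\<close>

section \<open>Pseudoinverses of matrices of full column rank\<close>

text \<open>On nested vectors \<open>norm\<close> is the Frobenius norm, so Cauchy-Schwarz applied
  to each row shows that it dominates the operator norm. This lets a Frobenius bound control the
  perturbation of a matrix.\<close>

lemma norm_matrix_vector_mult_le:
  fixes A :: "real^'n^'m"
  shows "norm (A *v v) \<le> norm A * norm v"
proof -
  have "norm (A *v v) \<le> L2_set (\<lambda>i. norm (A $ i) * norm v) UNIV"
    unfolding norm_vec_def[of "A *v v"]
    by (rule L2_set_mono) (auto simp: matrix_vector_mul_component Cauchy_Schwarz_ineq2)
  also have "\<dots> = norm A * norm v"
    by (simp add: norm_vec_def[of A] L2_set_left_distrib)
  finally show ?thesis .
qed

lemma norm_matrix_vector_mult_le_spec_norm:
  fixes A :: "real^'n^'m"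
  shows "norm (A *v v) \<le> spec_norm A * norm v"
  unfolding spec_norm_def by (rule onorm[OF matrix_vector_mul_bounded_linear])

text \<open>The four Penrose equations, split off from the definite description in
  \<open>pinv\<close> so that uniqueness and existence can be treated separately.\<close>

definition penrose :: "real^'n^'m \<Rightarrow> real^'m^'n \<Rightarrow> bool" where
  "penrose A X \<longleftrightarrow> A ** X ** A = A \<and> X ** A ** X = X \<and>
     transpose (A ** X) = A ** X \<and> transpose (X ** A) = X ** A"

text \<open>The products \<open>A ** X\<close> and \<open>A ** Y\<close> are symmetric, and each
  absorbs the other because \<open>A ** Y ** A = A\<close>; transposing one absorption identity
  makes them equal. The same holds for \<open>X ** A\<close> and \<open>Y ** A\<close>, and then X =
  XAX = YAX = YAY = Y.\<close>

lemma penrose_unique: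
  assumes X: "penrose A X" and Y: "penrose A Y"
  shows "X = Y"
proof -
  note x = X[unfolded penrose_def] and y = Y[unfolded penrose_def]
  have "A ** X = (A ** Y) ** (A ** X)"
    using y by (simp add: matrix_mul_assoc)
  also have "\<dots> = transpose ((A ** X) ** (A ** Y))"
    using x y by (simp only: matrix_transpose_mul)
  also have "(A ** X) ** (A ** Y) = A ** Y"
    using x by (simp add: matrix_mul_assoc)
  finally have AX: "A ** X = A ** Y"
    using y by simp
  have "X ** A = (X ** A) ** (Y ** A)"
    using y by (simp flip: matrix_mul_assoc)
  also have "\<dots> = transpose ((Y ** A) ** (X ** A))"
    using x y by (simp only: matrix_transpose_mul)
  also have "(Y ** A) ** (X ** A) = Y ** A"
    using x by (simp flip: matrix_mul_assoc)
  finally have XA: "X ** A = Y ** A"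
    using y by simp
  have "X = X ** A ** X" using x by simp
  also have "\<dots> = Y ** (A ** X)" by (simp only: XA matrix_mul_assoc)
  also have "\<dots> = Y" using y by (simp only: AX matrix_mul_assoc)
  finally show ?thesis .
qed

text \<open>The Gram matrix \<open>G\<close> has the same trivial kernel as \<open>A\<close>, hence
  an inverse \<open>B\<close>, which is symmetric because \<open>G\<close> is. The witness is the
  least squares solution operator \<open>B ** transpose A\<close>.\<close>

lemma ex_penrose_if_injective:
  fixes A :: "real^'n^'m"
  assumes inj: "\<And>v. A *v v = 0 \<Longrightarrow> v = 0"
  obtains X where "penrose A X" "X ** A = mat 1"
proof -
  define G where "G = transpose A ** A"
  have "v = 0" if "G *v v = 0" for v
  proof -
    have "(A *v v) \<bullet> (A *v v) = v \<bullet> (G *v v)"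
      by (simp add: G_def dot_lmul_matrix flip: matrix_vector_mul_assoc)
         (metis dot_lmul_matrix transpose_matrix_vector inner_commute)
    with that show ?thesis using inj by simp
  qed
  then obtain B where BG: "B ** G = mat 1"
    using matrix_left_invertible_ker[of G] by blast
  then have GB: "G ** B = mat 1"
    by (simp add: matrix_left_right_inverse)
  have Gt: "transpose G = G"
    by (simp add: G_def matrix_transpose_mul)
  have "transpose B = transpose B ** (G ** B)"
    by (simp add: GB)
  also have "\<dots> = transpose (G ** B) ** B"
    by (simp only: matrix_transpose_mul Gt matrix_mul_assoc)
  finally have Bt: "transpose B = B"
    by (simp add: GB transpose_mat)
  define X where "X = B ** transpose A"
  have XA: "X ** A = mat 1"
    using BG by (simp add: X_def G_def matrix_mul_assoc)
  have "transpose (A ** X) = A ** X"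
    by (simp add: X_def matrix_transpose_mul Bt matrix_mul_assoc)
  then have "penrose A X"
    by (simp add: penrose_def XA transpose_mat flip: matrix_mul_assoc)
  with XA that show ?thesis by blast
qed

lemma pinv_if_injective:
  fixes A :: "real^'n^'m"
  assumes inj: "\<And>v. A *v v = 0 \<Longrightarrow> v = 0"
  shows "penrose A (pinv A)" and "pinv A ** A = mat 1"
proof -
  obtain X where X: "penrose A X" "X ** A = mat 1"
    using ex_penrose_if_injective[OF inj] by blast
  have "pinv A = (THE X. penrose A X)"
    by (simp add: pinv_def penrose_def)
  also have "\<dots> = X"
    using X(1) penrose_unique by blast
  finally have "pinv A = X" .
  with X show "penrose A (pinv A)" "pinv A ** A = mat 1" by simp_all
qed

text \<open>The matrix \<open>A ** pinv A\<close> is an orthogonal projection, hence nonexpansive,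
  and the lower bound is applied at the vector \<open>pinv A *v y\<close>. The number
  \<open>s\<close> stands in for the smallest singular value, so no singular value decomposition is
  needed.\<close>

lemma norm_pinv_mult_le:
  fixes A :: "real^'n^'m"
  assumes s: "s > 0" and lb: "\<And>v. s * norm v \<le> norm (A *v v)"
  shows "pinv A ** A = mat 1" and "s * norm (pinv A *v y) \<le> norm y"
proof -
  have inj: "v = 0" if "A *v v = 0" for v
    using lb[of v] s that by (simp add: mult_le_0_iff)
  have pen: "penrose A (pinv A)"
    using inj by (rule pinv_if_injective)
  show "pinv A ** A = mat 1"
    using inj by (rule pinv_if_injective)
  define R where "R = A ** pinv A"
  have R: "R ** R = R" "transpose R = R"
    using pen by (simp_all add: R_def penrose_def matrix_mul_assoc)
  have "norm (R *v y) ^ 2 = y \<bullet> (R *v y)"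
    unfolding power2_norm_eq_inner
    by (metis R dot_lmul_matrix transpose_matrix_vector matrix_vector_mul_assoc inner_commute)
  also have "\<dots> \<le> norm y * norm (R *v y)"
    by (rule norm_cauchy_schwarz)
  finally have "norm (R *v y) \<le> norm y"
    by (cases "norm (R *v y) = 0") (simp_all add: power2_eq_square)
  then show "s * norm (pinv A *v y) \<le> norm y"
    using lb[of "pinv A *v y"] by (simp add: R_def matrix_vector_mul_assoc)
qed

text \<open>A Weyl type argument: since \<open>pinv A\<close> is a left inverse, \<open>A\<close> is
  bounded below by the reciprocal of \<open>spec_norm (pinv A)\<close>, and the triangle inequality
  passes this bound to \<open>B\<close> with a loss of the factor 1 - c.\<close>

lemma norm_pinv_perturbation_le:
  fixes A B :: "real^'n^'m"
  assumes rank: "rank A = CARD('n)"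
    and close: "norm (B - A) * spec_norm (pinv A) \<le> c" and c: "c < 1"
  shows "spec_norm (pinv A) > 0" and "pinv B ** B = mat 1"
    and "(1 - c) * norm (pinv B *v y) \<le> spec_norm (pinv A) * norm y"
proof -
  let ?t = "spec_norm (pinv A)"
  have "inj ((*v) A)"
    using rank by (simp add: full_rank_injective)
  then have inj: "v = 0" if "A *v v = 0" for v
    using that by (metis injD matrix_vector_mult_0_right)
  have pA: "pinv A ** A = mat 1"
    using inj by (rule pinv_if_injective)
  have lbA: "norm v \<le> ?t * norm (A *v v)" for v
    using norm_matrix_vector_mult_le_spec_norm[of "pinv A" "A *v v"] pA
    by (simp add: matrix_vector_mul_assoc)
  \<comment> \<open>Any unit vector would do; its norm 1 rules out that \<open>?t\<close>
    vanishes.\<close>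
  from lbA[of "axis undefined 1"] have "0 < ?t * norm (A *v axis undefined 1)"
    by (simp add: norm_axis_1 less_le_trans[OF zero_less_one])
  then show t: "?t > 0"
    by (simp add: zero_less_mult_iff)
  have lbB: "(1 - c) / ?t * norm v \<le> norm (B *v v)" for v
  proof -
    have "norm (A *v v) \<le> norm (B *v v) + norm ((B - A) *v v)"
      by (metis matrix_vector_mult_diff_rdistrib norm_triangle_sub norm_minus_commute)
    also have "norm ((B - A) *v v) \<le> norm (B - A) * norm v"
      by (rule norm_matrix_vector_mult_le)
    finally have "?t * norm (A *v v) \<le> ?t * (norm (B *v v) + norm (B - A) * norm v)"
      using t by simp
    moreover have "norm (B - A) * ?t * norm v \<le> c * norm v"
      by (rule mult_right_mono[OF close]) simp
    ultimately have "(1 - c) * norm v \<le> ?t * norm (B *v v)"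
      using lbA[of v] by (simp add: algebra_simps)
    with t show ?thesis by (simp add: field_simps)
  qed
  have "(1 - c) / ?t > 0" using t c by simp
  note B = norm_pinv_mult_le[OF this lbB]
  show "pinv B ** B = mat 1" by (fact B(1))
  show "(1 - c) * norm (pinv B *v y) \<le> ?t * norm y"
    using B(2)[of y] t by (simp add: field_simps)
qed

text \<open>The threshold is chosen so that 1 - c = 1 / sqrt 2, whence the pseudoinverse grows by at
  most the factor sqrt 2. As \<open>pinv B\<close> is a left inverse of \<open>B\<close>, the error
  is \<open>pinv B\<close> applied to the residual b - Bv.\<close>

lemma norm_pinv_solution_perturbation_le:
  fixes A B :: "real^'n^'m"
  assumes rank: "rank A = CARD('n)"
    and close: "norm (B - A) * spec_norm (pinv A) \<le> 1 - 1 / sqrt 2"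
  shows "norm (pinv B *v b - v)
    \<le> sqrt 2 * spec_norm (pinv A) * (norm (b - A *v v) + norm (B - A) * norm v)"
proof -
  have "(1 - 1 / sqrt 2 :: real) < 1" by simp
  note pert = norm_pinv_perturbation_le[OF rank close this]
  define r where "r = b - A *v v - (B - A) *v v"
  have "pinv B *v b - v = pinv B *v (b - B *v v)"
    using pert(2) by (simp add: matrix_vector_mult_diff_distrib matrix_vector_mul_assoc)
  also have "b - B *v v = r"
    by (simp add: r_def matrix_vector_mult_diff_rdistrib)
  finally have "norm (pinv B *v b - v) \<le> sqrt 2 * spec_norm (pinv A) * norm r"
    using pert(3)[of r] by (simp add: field_simps)
  also have "norm r \<le> norm (b - A *v v) + norm (B - A) * norm v"
    unfolding r_def by (intro norm_triangle_le_diff add_left_mono norm_matrix_vector_mult_le)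
  finally show ?thesis
    using pert(1) by simp
qed

lemma norm_vec_le_sqrt_card:
  fixes v :: "real^'n"
  assumes "e \<ge> 0" "\<And>i. \<bar>v $ i\<bar> \<le> e"
  shows "norm v \<le> sqrt (real CARD('n)) * e"
proof -
  have "norm v \<le> L2_set (\<lambda>i::'n. e) UNIV"
    unfolding norm_vec_def using assms by (intro L2_set_mono) auto
  also have "\<dots> = sqrt (real CARD('n)) * e"
    using assms(1) by (simp add: L2_set_def real_sqrt_mult)
  finally show ?thesis .
qed

section \<open>Concentration of empirical means\<close>

text \<open>An oscillation of at most c puts all values between the infimum of \<open>f\<close> and
  that infimum plus c, so Hoeffding's lemma for an interval applies. The endpoints may then depend
  on frozen coordinates, as the induction below requires.\<close>

lemma (in prob_space) Hoeffdings_lemma_oscillation: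
  fixes f :: "'a \<Rightarrow> real"
  assumes f: "f \<in> borel_measurable M" and l: "l > 0"
    and osc: "\<And>x y. x \<in> space M \<Longrightarrow> y \<in> space M \<Longrightarrow> f x \<le> f y + c"
  shows "(\<integral>\<^sup>+x. ennreal (exp (l * (f x - expectation f))) \<partial>M) \<le> ennreal (exp (l\<^sup>2 * c\<^sup>2 / 8))"
proof -
  define a where "a = (INF x\<in>space M. f x)"
  obtain x0 where x0: "x0 \<in> space M"
    using not_empty by blast
  have "f x0 - c \<le> f x" if "x \<in> space M" for x
    using osc[OF x0 that] by simp
  then have "bdd_below (f ` space M)"
    by (intro bdd_belowI2)
  then have "a \<le> f x" if "x \<in> space M" for x
    unfolding a_def using that by (rule cINF_lower)
  moreover have "f x - c \<le> a" if "x \<in> space M" for x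
    unfolding a_def using not_empty osc[OF that] by (intro cINF_greatest) (auto simp: algebra_simps)
  ultimately interpret interval_bounded_random_variable M f a "a + c"
    by unfold_locales (use f in \<open>auto simp: algebra_simps\<close>)
  show ?thesis
    using Hoeffdings_lemma_nn_integral[OF l] by simp
qed

lemma (in prob_space) integrable_bounded:
  fixes f :: "'a \<Rightarrow> 'b::{banach, second_countable_topology}"
  assumes "f \<in> borel_measurable M" "\<And>x. x \<in> space M \<Longrightarrow> norm (f x) \<le> K"
  shows "integrable M f"
  using assms by (intro integrable_const_bound[where B = K] AE_I2) auto

text \<open>Taking values in an arbitrary Euclidean space lets one notion serve both scalar
  coordinates and whole matrices.\<close>

definition mean_dev :: "'a measure \<Rightarrow> 'i set \<Rightarrow> ('a \<Rightarrow> 'b::euclidean_space) \<Rightarrow> ('i \<Rightarrow> 'a) \<Rightarrow> 'b" where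
  "mean_dev P I h x = (1 / real (card I)) *\<^sub>R (\<Sum>i\<in>I. h (x i)) - (\<integral>y. h y \<partial>P)"

lemma borel_measurable_mean_dev [measurable]:
  assumes [measurable]: "h \<in> borel_measurable P"
  shows "mean_dev P I h \<in> borel_measurable (PiM I (\<lambda>_. P))"
  unfolding mean_dev_def by measurable

section \<open>Product measures: bounded differences and deviations of empirical means\<close>

context
  fixes P :: "'a measure"
  assumes prob: "prob_space P"
begin

interpretation P: prob_space P by (fact prob)
interpretation PP: product_sigma_finite "\<lambda>_. P" by standard
interpretation Pi: prob_space "PiM I (\<lambda>_. P)" for I :: "'i set" by (intro prob_space_PiM prob)

text \<open>Induction over the coordinates replaces the usual martingale. Averaging out one
  coordinate leaves a function with the same bounded differences, and Hoeffding's lemma in that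
  coordinate, with the others frozen, costs one factor exp (l^2 c^2 / 8). The bound K supplies
  integrability.\<close>

lemma bounded_differences_mgf:
  fixes f :: "('i \<Rightarrow> 'a) \<Rightarrow> real"
  assumes "finite I" and l: "l > 0"
    and "f \<in> borel_measurable (PiM I (\<lambda>_. P))"
    and "\<And>x. x \<in> space (PiM I (\<lambda>_. P)) \<Longrightarrow> \<bar>f x\<bar> \<le> K"
    and "\<And>x i y. x \<in> space (PiM I (\<lambda>_. P)) \<Longrightarrow> i \<in> I \<Longrightarrow> y \<in> space P \<Longrightarrow> f (x(i := y)) \<le> f x + c"
  shows "(\<integral>\<^sup>+x. ennreal (exp (l * (f x - (\<integral>x. f x \<partial>PiM I (\<lambda>_. P))))) \<partial>PiM I (\<lambda>_. P))
           \<le> ennreal (exp (l\<^sup>2 * (real (card I) * c\<^sup>2) / 8))"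
  using assms(1,3-)
proof (induction I arbitrary: f rule: finite_induct)
  case empty
  then show ?case
    by (simp add: PiM_empty nn_integral_count_space_finite lebesgue_integral_count_space_finite)
next
  case (insert i I)
  let ?M = "\<lambda>I. PiM I (\<lambda>_. P)"
  note [measurable] = insert.prems(1)
  have upd: "x(i := y) \<in> space (?M (insert i I))" if "x \<in> space (?M I)" "y \<in> space P" for x y
    using that by (auto simp: space_PiM PiE_def extensional_def)
  define F where "F = (\<lambda>x. \<integral>y. f (x(i := y)) \<partial>P)"
  define E where "E = (\<integral>x. f x \<partial>?M (insert i I))"
  have meas: "(\<lambda>y. f (x(i := y))) \<in> borel_measurable P" if "x \<in> space (?M I)" for x
    using measurable_comp[OF measurable_component_update insert.prems(1), OF that insert.hyps(2)]
    by (simp add: comp_def fun_upd_def)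
  have int: "integrable P (\<lambda>y. f (x(i := y)))" if "x \<in> space (?M I)" for x
    using meas[OF that] insert.prems(2) upd[OF that] by (intro P.integrable_bounded[where K = K]) auto
  have F_meas [measurable]: "F \<in> borel_measurable (?M I)"
    unfolding F_def by measurable
  have F_bnd: "\<bar>F x\<bar> \<le> K" if "x \<in> space (?M I)" for x
  proof -
    have "norm (F x) \<le> (\<integral>y. norm (f (x(i := y))) \<partial>P)"
      unfolding F_def by (rule integral_norm_bound)
    also have "\<dots> \<le> (\<integral>y. K \<partial>P)"
      using insert.prems(2) upd[OF that] int[OF that] by (intro integral_mono) auto
    finally show ?thesis by (simp add: P.prob_space)
  qed
  have F_diff: "F (x(j := z)) \<le> F x + c" if x: "x \<in> space (?M I)" and j: "j \<in> I" and z: "z \<in> space P" for x j z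
  proof -
    have x': "x(j := z) \<in> space (?M I)"
      using x j z by (auto simp: space_PiM PiE_def extensional_def)
    have "F (x(j := z)) \<le> (\<integral>y. f (x(i := y)) + c \<partial>P)"
      unfolding F_def
    proof (rule integral_mono)
      show "integrable P (\<lambda>y. f (x(j := z, i := y)))"
        by (rule int[OF x'])
      show "integrable P (\<lambda>y. f (x(i := y)) + c)"
        using int[OF x] by simp
      fix y assume y: "y \<in> space P"
      have "f (x(i := y, j := z)) \<le> f (x(i := y)) + c"
        using j by (intro insert.prems(3) upd x y z) simp
      also have "x(i := y, j := z) = x(j := z, i := y)"
        using j insert.hyps(2) by (intro fun_upd_twist) auto
      finally show "f (x(j := z, i := y)) \<le> f (x(i := y)) + c" .
    qed
    also have "\<dots> = F x + c"
      unfolding F_def using int[OF x] by (simp add: P.prob_space)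
    finally show ?thesis .
  qed
  \<comment> \<open>By Fubini \<open>F\<close> has the same mean as \<open>f\<close>, so the
    induction hypothesis for \<open>F\<close> is centred at the right constant.\<close>
  have E: "E = (\<integral>x. F x \<partial>?M I)"
    unfolding E_def F_def using insert.hyps insert.prems(2)
    by (intro PP.product_integral_insert Pi.integrable_bounded[where K = K]) auto
  have "(\<integral>\<^sup>+x. ennreal (exp (l * (f x - E))) \<partial>?M (insert i I)) =
        (\<integral>\<^sup>+x. \<integral>\<^sup>+y. ennreal (exp (l * (f (x(i := y)) - E))) \<partial>P \<partial>?M I)"
    using insert.hyps by (intro PP.product_nn_integral_insert) auto
  also have "\<dots> \<le> (\<integral>\<^sup>+x. ennreal (exp (l\<^sup>2 * c\<^sup>2 / 8)) * ennreal (exp (l * (F x - E))) \<partial>?M I)"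
  proof (rule nn_integral_mono)
    fix x assume x: "x \<in> space (?M I)"
    note [measurable] = meas[OF x]
    have "(\<integral>\<^sup>+y. ennreal (exp (l * (f (x(i := y)) - E))) \<partial>P) =
          (\<integral>\<^sup>+y. ennreal (exp (l * (F x - E))) * ennreal (exp (l * (f (x(i := y)) - F x))) \<partial>P)"
      by (intro nn_integral_cong) (simp add: algebra_simps flip: ennreal_mult exp_add)
    also have "\<dots> = ennreal (exp (l * (F x - E))) * (\<integral>\<^sup>+y. ennreal (exp (l * (f (x(i := y)) - F x))) \<partial>P)"
      by (intro nn_integral_cmult) measurable
    also have "\<dots> \<le> ennreal (exp (l * (F x - E))) * ennreal (exp (l\<^sup>2 * c\<^sup>2 / 8))"
    proof (intro mult_left_mono)
      have "f (x(i := y)) \<le> f (x(i := y')) + c" if "y \<in> space P" "y' \<in> space P" for y y'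
      proof -
        \<comment> \<open>The second update overwrites the first, so two values at coordinate i are
          compared through a single change at the point \<open>x(i := y')\<close>.\<close>
        have "f (x(i := y', i := y)) \<le> f (x(i := y')) + c"
          by (intro insert.prems(3) upd x that) simp
        then show ?thesis by (simp only: fun_upd_upd)
      qed
      then show "(\<integral>\<^sup>+y. ennreal (exp (l * (f (x(i := y)) - F x))) \<partial>P) \<le> ennreal (exp (l\<^sup>2 * c\<^sup>2 / 8))"
        unfolding F_def by (rule P.Hoeffdings_lemma_oscillation[OF meas[OF x] l])
    qed simp
    finally show "(\<integral>\<^sup>+y. ennreal (exp (l * (f (x(i := y)) - E))) \<partial>P)
        \<le> ennreal (exp (l\<^sup>2 * c\<^sup>2 / 8)) * ennreal (exp (l * (F x - E)))"
      by (simp add: mult.commute)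
  qed
  also have "\<dots> = ennreal (exp (l\<^sup>2 * c\<^sup>2 / 8)) * (\<integral>\<^sup>+x. ennreal (exp (l * (F x - E))) \<partial>?M I)"
    by (intro nn_integral_cmult) measurable
  also have "\<dots> \<le> ennreal (exp (l\<^sup>2 * c\<^sup>2 / 8)) * ennreal (exp (l\<^sup>2 * (real (card I) * c\<^sup>2) / 8))"
    unfolding E by (intro mult_left_mono insert.IH F_meas F_bnd F_diff) auto
  also have "\<dots> = ennreal (exp (l\<^sup>2 * (real (card (insert i I)) * c\<^sup>2) / 8))"
    using insert.hyps by (simp add: algebra_simps add_divide_distrib flip: ennreal_mult exp_add)
  finally show ?case
    by (simp add: E_def)
qed

text \<open>McDiarmid's inequality, by the Chernoff method from the bound on the moment generating
  function. For t = 0 the right side is 1; this case is separate because the parameter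
  \<open>l\<close> would be 0.\<close>

theorem bounded_differences_inequality:
  fixes f :: "('i \<Rightarrow> 'a) \<Rightarrow> real"
  assumes I: "finite I" "I \<noteq> {}" and c: "c > 0" and t: "t \<ge> 0"
    and f [measurable]: "f \<in> borel_measurable (PiM I (\<lambda>_. P))"
    and bnd: "\<And>x. x \<in> space (PiM I (\<lambda>_. P)) \<Longrightarrow> \<bar>f x\<bar> \<le> K"
    and diff: "\<And>x i y. x \<in> space (PiM I (\<lambda>_. P)) \<Longrightarrow> i \<in> I \<Longrightarrow> y \<in> space P \<Longrightarrow> f (x(i := y)) \<le> f x + c"
  shows "measure (PiM I (\<lambda>_. P))
           {x \<in> space (PiM I (\<lambda>_. P)). f x \<ge> (\<integral>x. f x \<partial>PiM I (\<lambda>_. P)) + t}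
         \<le> exp (- 2 * t\<^sup>2 / (real (card I) * c\<^sup>2))"
proof (cases "t = 0")
  case True
  then show ?thesis by simp
next
  case False
  let ?M = "PiM I (\<lambda>_. P)"
  define E where "E = (\<integral>x. f x \<partial>?M)"
  define d where "d = real (card I) * c\<^sup>2"
  have d: "d > 0"
    using I c by (simp add: d_def card_gt_0_iff)
  \<comment> \<open>The minimiser of \<open>- l * t + l\<^sup>2 * d / 8\<close>.\<close>
  define l where "l = 4 * t / d"
  have l: "l > 0"
    using False t d by (simp add: l_def)
  have "ennreal (measure ?M {x \<in> space ?M. f x \<ge> E + t}) = emeasure ?M {x \<in> space ?M. f x - E \<ge> t}"
    by (simp add: Pi.emeasure_eq_measure algebra_simps)
  also have "\<dots> \<le> ennreal (exp (- l * t)) * (\<integral>\<^sup>+x\<in>space ?M. ennreal (exp (l * (f x - E))) \<partial>?M)"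
    by (intro Chernoff_ineq_nn_integral_ge l) auto
  also have "(\<integral>\<^sup>+x\<in>space ?M. ennreal (exp (l * (f x - E))) \<partial>?M) = (\<integral>\<^sup>+x. ennreal (exp (l * (f x - E))) \<partial>?M)"
    by (intro nn_integral_cong) simp
  also have "ennreal (exp (- l * t)) * \<dots> \<le> ennreal (exp (- l * t)) * ennreal (exp (l\<^sup>2 * d / 8))"
    unfolding E_def d_def by (intro mult_left_mono bounded_differences_mgf[where K = K] I l f bnd diff) auto
  also have "\<dots> = ennreal (exp (- l * t + l\<^sup>2 * d / 8))"
    by (simp flip: ennreal_mult exp_add)
  also have "- l * t + l\<^sup>2 * d / 8 = - 2 * t\<^sup>2 / d"
    using d by (simp add: l_def field_simps power2_eq_square)
  finally show ?thesis
    by (simp add: E_def d_def)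
qed

lemma integral_PiM_component:
  fixes h :: "'a \<Rightarrow> 'b::{banach, second_countable_topology}"
  assumes "i \<in> I" "h \<in> borel_measurable P"
  shows "(\<integral>x. h (x i) \<partial>PiM I (\<lambda>_. P)) = (\<integral>y. h y \<partial>P)"
proof -
  have "(\<integral>y. h y \<partial>P) = (\<integral>y. h y \<partial>distr (PiM I (\<lambda>_. P)) P (\<lambda>x. x i))"
    using distr_PiM_component[of I "\<lambda>_. P" i] prob assms(1) by simp
  also have "\<dots> = (\<integral>x. h (x i) \<partial>PiM I (\<lambda>_. P))"
    using assms by (intro integral_distr) auto
  finally show ?thesis by simp
qed

text \<open>Orthogonality of independent centred vectors: when one coordinate is integrated out, the
  cross term is an inner product with the mean of \<open>Y\<close>, which is 0.\<close>

lemma integral_norm_sum_squared: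
  fixes Y :: "'a \<Rightarrow> 'b::euclidean_space" and I :: "'i set"
  assumes I: "finite I" and Y [measurable]: "Y \<in> borel_measurable P"
    and bnd: "\<And>y. y \<in> space P \<Longrightarrow> norm (Y y) \<le> K" and mean: "(\<integral>y. Y y \<partial>P) = 0"
  shows "(\<integral>x. (norm (\<Sum>i\<in>I. Y (x i)))\<^sup>2 \<partial>PiM I (\<lambda>_. P)) = real (card I) * (\<integral>y. (norm (Y y))\<^sup>2 \<partial>P)"
  using I
proof (induction I rule: finite_induct)
  case empty
  then show ?case by simp
next
  case (insert i I)
  let ?M = "\<lambda>I. PiM I (\<lambda>_. P)"
  define V where "V = (\<integral>y. (norm (Y y))\<^sup>2 \<partial>P)"
  have int: "integrable P Y"
    by (intro P.integrable_bounded[where K = K] bnd Y)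
  have intV: "integrable P (\<lambda>y. (norm (Y y))\<^sup>2)"
    using bnd by (intro P.integrable_bounded[where K = "K\<^sup>2"]) (auto intro!: power_mono)
  have intS: "integrable (?M J) (\<lambda>x. (norm (\<Sum>i\<in>J. Y (x i)))\<^sup>2)" if "finite J" for J :: "'i set"
  proof (rule Pi.integrable_bounded)
    show "norm ((norm (\<Sum>i\<in>J. Y (x i)))\<^sup>2) \<le> (real (card J) * K)\<^sup>2" if "x \<in> space (?M J)" for x
    proof -
      have "norm (\<Sum>i\<in>J. Y (x i)) \<le> real (card J) * K"
        using that by (intro sum_norm_bound bnd) (auto simp: space_PiM)
      then show ?thesis by (simp add: power_mono)
    qed
  qed measurable
  have "(\<integral>x. (norm (\<Sum>i\<in>insert i I. Y (x i)))\<^sup>2 \<partial>?M (insert i I)) =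
        (\<integral>x. (\<integral>y. (norm (\<Sum>j\<in>insert i I. Y ((x(i := y)) j)))\<^sup>2 \<partial>P) \<partial>?M I)"
    using insert.hyps intS[of "insert i I"] by (intro PP.product_integral_insert) auto
  also have "\<dots> = (\<integral>x. (norm (\<Sum>i\<in>I. Y (x i)))\<^sup>2 + V \<partial>?M I)"
  proof (rule Bochner_Integration.integral_cong[OF refl])
    fix x
    let ?s = "\<Sum>i\<in>I. Y (x i)"
    have "(\<Sum>j\<in>I. Y ((x(i := y)) j)) = ?s" for y
      using insert.hyps by (intro sum.cong) auto
    then have "(\<integral>y. (norm (\<Sum>j\<in>insert i I. Y ((x(i := y)) j)))\<^sup>2 \<partial>P)
        = (\<integral>y. (norm ?s)\<^sup>2 + 2 * (?s \<bullet> Y y) + (norm (Y y))\<^sup>2 \<partial>P)"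
      using insert.hyps by (simp add: power2_norm_eq_inner inner_add inner_commute algebra_simps)
    also have "\<dots> = (norm ?s)\<^sup>2 + 2 * (?s \<bullet> (\<integral>y. Y y \<partial>P)) + V"
      using int intV by (simp add: V_def P.prob_space)
    finally show "(\<integral>y. (norm (\<Sum>j\<in>insert i I. Y ((x(i := y)) j)))\<^sup>2 \<partial>P) = (norm ?s)\<^sup>2 + V"
      by (simp add: mean)
  qed
  also have "\<dots> = real (card I) * V + V"
    using intS[OF insert.hyps(1)] by (simp add: insert.IH V_def Pi.prob_space)
  finally show ?case
    using insert.hyps by (simp add: V_def algebra_simps)
qed

text \<open>The second moment of the deviation is at most B^2 / n, and its root bounds the first
  moment. Neither step depends on the dimension of the target space.\<close>

lemma expectation_norm_mean_dev_le:
  fixes h :: "'a \<Rightarrow> 'b::euclidean_space" and I :: "'i set"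
  assumes I: "finite I" "I \<noteq> {}" and h [measurable]: "h \<in> borel_measurable P"
    and bnd: "\<And>y. y \<in> space P \<Longrightarrow> norm (h y) \<le> B"
  shows "(\<integral>x. norm (mean_dev P I h x) \<partial>PiM I (\<lambda>_. P)) \<le> B / sqrt (real (card I))"
proof -
  let ?M = "PiM I (\<lambda>_. P)"
  define n where "n = real (card I)"
  have n: "n > 0" using I by (simp add: n_def card_gt_0_iff)
  have B: "B \<ge> 0"
    using bnd P.not_empty norm_ge_zero order_trans by blast
  define \<mu> where "\<mu> = (\<integral>y. h y \<partial>P)"
  define Y where "Y = (\<lambda>y. h y - \<mu>)"
  have Y [measurable]: "Y \<in> borel_measurable P" by (simp add: Y_def)
  have int: "integrable P h"
    by (intro P.integrable_bounded[where K = B] bnd h)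
  have inth2: "integrable P (\<lambda>y. (norm (h y))\<^sup>2)"
    using bnd by (intro P.integrable_bounded[where K = "B\<^sup>2"]) (auto intro!: power_mono)
  have mean: "(\<integral>y. Y y \<partial>P) = 0"
    using int by (simp add: Y_def \<mu>_def P.prob_space)
  have Ybnd: "norm (Y y) \<le> B + norm \<mu>" if "y \<in> space P" for y
    using norm_triangle_ineq4[of "h y" \<mu>] bnd[OF that] by (simp add: Y_def)
  \<comment> \<open>Centring does not increase the second moment, so \<open>B\<close> survives as
    the constant; the pointwise bound \<open>Ybnd\<close> is larger and serves only
    integrability.\<close>
  have "(\<integral>y. (norm (Y y))\<^sup>2 \<partial>P) = (\<integral>y. (norm (h y))\<^sup>2 - 2 * (\<mu> \<bullet> h y) + (norm \<mu>)\<^sup>2 \<partial>P)"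
    by (simp add: Y_def power2_norm_eq_inner inner_diff inner_commute algebra_simps)
  also have "\<dots> = (\<integral>y. (norm (h y))\<^sup>2 \<partial>P) - (norm \<mu>)\<^sup>2"
    using int inth2 by (simp add: P.prob_space \<mu>_def[symmetric] power2_norm_eq_inner)
  also have "\<dots> \<le> (\<integral>y. (norm (h y))\<^sup>2 \<partial>P)" by simp
  also have "\<dots> \<le> (\<integral>y. B\<^sup>2 \<partial>P)"
    using bnd inth2 by (intro integral_mono) (auto intro!: power_mono)
  finally have V: "(\<integral>y. (norm (Y y))\<^sup>2 \<partial>P) \<le> B\<^sup>2"
    by (simp add: P.prob_space)
  have dev: "mean_dev P I h x = (1 / n) *\<^sub>R (\<Sum>i\<in>I. Y (x i))" for x
    using n by (simp add: mean_dev_def Y_def sum_subtractf n_def \<mu>_def scaleR_diff_right sum_constant_scaleR)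
  let ?f = "\<lambda>x. norm (mean_dev P I h x)"
  have f_meas [measurable]: "?f \<in> borel_measurable ?M"
    unfolding dev by measurable
  have f_bnd: "?f x \<le> B + norm \<mu>" if "x \<in> space ?M" for x
  proof -
    have "norm (\<Sum>i\<in>I. Y (x i)) \<le> n * (B + norm \<mu>)"
      unfolding n_def using that by (intro sum_norm_bound Ybnd) (auto simp: space_PiM)
    then show ?thesis using n by (simp add: dev field_simps)
  qed
  have i1: "integrable ?M ?f"
    by (rule Pi.integrable_bounded[OF f_meas]) (use f_bnd in auto)
  have i2: "integrable ?M (\<lambda>x. (?f x)\<^sup>2)"
    by (rule Pi.integrable_bounded[where K = "(B + norm \<mu>)\<^sup>2"]) (use f_bnd in \<open>auto intro!: power_mono\<close>)
  \<comment> \<open>Jensen's inequality for the square, read off from the nonnegative variance of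
    the norm.\<close>
  have "(\<integral>x. ?f x \<partial>?M)\<^sup>2 \<le> (\<integral>x. (?f x)\<^sup>2 \<partial>?M)"
    using Pi.variance_eq[OF i1 i2] Pi.variance_positive[of I ?f] by linarith
  also have "\<dots> = (\<integral>x. (norm (\<Sum>i\<in>I. Y (x i)))\<^sup>2 \<partial>?M) / n\<^sup>2"
    by (simp add: dev power_divide)
  also have "\<dots> = (\<integral>y. (norm (Y y))\<^sup>2 \<partial>P) / n"
    using integral_norm_sum_squared[OF I(1) Y Ybnd mean] n by (simp add: n_def power2_eq_square)
  also have "\<dots> \<le> B\<^sup>2 / n"
    using V n by (intro divide_right_mono) auto
  also have "\<dots> = (B / sqrt n)\<^sup>2"
    using n by (simp add: power_divide)
  finally have "(\<integral>x. ?f x \<partial>?M) \<le> B / sqrt n"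
    by (rule power2_le_imp_le) (use B n in simp)
  then show ?thesis
    by (simp only: n_def)
qed

text \<open>Replacing one sample moves the empirical mean by at most 2B / n, and a 1-Lipschitz
  function of it by no more. The threshold makes the exponent exactly -L. The function \<phi> is
  left open to cover the norm as well as both signs of a scalar deviation.\<close>

lemma mean_dev_lipschitz_tail:
  fixes h :: "'a \<Rightarrow> 'b::euclidean_space" and I :: "'i set"
  assumes I: "finite I" "I \<noteq> {}" and h [measurable]: "h \<in> borel_measurable P"
    and bnd: "\<And>y. y \<in> space P \<Longrightarrow> norm (h y) \<le> B" and B: "B > 0" and L: "L \<ge> 0"
    and \<phi> [measurable]: "\<phi> \<in> borel_measurable borel"
    and lip: "\<And>u v. \<phi> u \<le> \<phi> v + norm (u - v)"
  shows "measure (PiM I (\<lambda>_. P)) {x \<in> space (PiM I (\<lambda>_. P)).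
      \<phi> (mean_dev P I h x) \<ge> (\<integral>x. \<phi> (mean_dev P I h x) \<partial>PiM I (\<lambda>_. P)) + B / sqrt (real (card I)) * sqrt (2 * L)}
    \<le> exp (- L)"
proof -
  let ?M = "PiM I (\<lambda>_. P)"
  define n where "n = real (card I)"
  have n: "n > 0" using I by (simp add: n_def card_gt_0_iff)
  define t where "t = B / sqrt n * sqrt (2 * L)"
  define \<mu> where "\<mu> = (\<integral>y. h y \<partial>P)"
  have bounded: "\<bar>\<phi> (mean_dev P I h x)\<bar> \<le> \<bar>\<phi> 0\<bar> + (B + norm \<mu>)" if "x \<in> space ?M" for x
  proof -
    have "norm (\<Sum>i\<in>I. h (x i)) \<le> n * B"
      unfolding n_def using that by (intro sum_norm_bound bnd) (auto simp: space_PiM)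
    then have "norm ((1 / n) *\<^sub>R (\<Sum>i\<in>I. h (x i))) \<le> B"
      using n by (simp add: field_simps)
    then have "norm (mean_dev P I h x) \<le> B + norm \<mu>"
      unfolding mean_dev_def n_def[symmetric] \<mu>_def[symmetric]
      by (intro norm_triangle_le_diff add_right_mono)
    then show ?thesis
      using lip[of "mean_dev P I h x" 0] lip[of 0 "mean_dev P I h x"] by auto
  qed
  have diff: "\<phi> (mean_dev P I h (x(i := y))) \<le> \<phi> (mean_dev P I h x) + 2 * B / n"
    if x: "x \<in> space ?M" and i: "i \<in> I" and y: "y \<in> space P" for x i y
  proof -
    have "(\<Sum>j\<in>I. h ((x(i := y)) j)) - (\<Sum>j\<in>I. h (x j)) = (\<Sum>j\<in>I. if j = i then h y - h (x i) else 0)"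
      unfolding sum_subtractf[symmetric] by (intro sum.cong) auto
    also have "\<dots> = h y - h (x i)"
      using I i by simp
    finally have sum: "(\<Sum>j\<in>I. h ((x(i := y)) j)) - (\<Sum>j\<in>I. h (x j)) = h y - h (x i)" .
    have "mean_dev P I h (x(i := y)) - mean_dev P I h x
        = (1 / n) *\<^sub>R ((\<Sum>j\<in>I. h ((x(i := y)) j)) - (\<Sum>j\<in>I. h (x j)))"
      unfolding mean_dev_def n_def scaleR_diff_right by simp
    then have "mean_dev P I h (x(i := y)) - mean_dev P I h x = (1 / n) *\<^sub>R (h y - h (x i))"
      by (simp only: sum)
    then have "norm (mean_dev P I h (x(i := y)) - mean_dev P I h x) = norm (h y - h (x i)) / n"
      using n by simp
    also have "norm (h y - h (x i)) \<le> B + B"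
      using x i y by (intro norm_triangle_le_diff add_mono bnd) (auto simp: space_PiM)
    finally have "norm (mean_dev P I h (x(i := y)) - mean_dev P I h x) \<le> 2 * B / n"
      using n by (simp add: divide_right_mono)
    then show ?thesis
      using lip[of "mean_dev P I h (x(i := y))" "mean_dev P I h x"] by linarith
  qed
  have "measure ?M {x \<in> space ?M. \<phi> (mean_dev P I h x) \<ge> (\<integral>x. \<phi> (mean_dev P I h x) \<partial>?M) + t}
      \<le> exp (- 2 * t\<^sup>2 / (real (card I) * (2 * B / n)\<^sup>2))"
    using I B L n by (intro bounded_differences_inequality[OF _ _ _ _ _ bounded diff]) (auto simp: t_def)
  also have "t\<^sup>2 = B\<^sup>2 / n * (2 * L)"
    using L n by (simp add: t_def power_mult_distrib power_divide)
  also have "- 2 * (B\<^sup>2 / n * (2 * L)) / (real (card I) * (2 * B / n)\<^sup>2) = - L"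
    unfolding n_def[symmetric] using B n by (simp add: power2_eq_square)
  finally show ?thesis by (simp add: t_def n_def)
qed

text \<open>The summand 1 pays for the expected norm, and sqrt (2L) for the fluctuation around
  it.\<close>

lemma norm_mean_dev_tail:
  fixes h :: "'a \<Rightarrow> 'b::euclidean_space" and I :: "'i set"
  assumes I: "finite I" "I \<noteq> {}" and h [measurable]: "h \<in> borel_measurable P"
    and bnd: "\<And>y. y \<in> space P \<Longrightarrow> norm (h y) \<le> B" and B: "B > 0" and L: "L \<ge> 0"
  shows "measure (PiM I (\<lambda>_. P)) {x \<in> space (PiM I (\<lambda>_. P)).
      norm (mean_dev P I h x) \<ge> B / sqrt (real (card I)) * (1 + sqrt (2 * L))} \<le> exp (- L)"
proof -
  have "measure (PiM I (\<lambda>_. P)) {x \<in> space (PiM I (\<lambda>_. P)).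
      norm (mean_dev P I h x) \<ge> B / sqrt (real (card I)) * (1 + sqrt (2 * L))}
    \<le> measure (PiM I (\<lambda>_. P)) {x \<in> space (PiM I (\<lambda>_. P)). norm (mean_dev P I h x)
       \<ge> (\<integral>x. norm (mean_dev P I h x) \<partial>PiM I (\<lambda>_. P)) + B / sqrt (real (card I)) * sqrt (2 * L)}"
    using expectation_norm_mean_dev_le[OF I h bnd]
    by (intro Pi.finite_measure_mono) (auto simp: algebra_simps)
  also have "\<dots> \<le> exp (- L)"
    by (intro mean_dev_lipschitz_tail I h bnd B L norm_triangle_sub) auto
  finally show ?thesis .
qed

text \<open>A scalar deviation has mean 0, so no expectation term appears; the two tails come from
  \<phi> = identity and \<phi> = negation.\<close>

lemma abs_mean_dev_tail:
  fixes h :: "'a \<Rightarrow> real" and I :: "'i set"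
  assumes I: "finite I" "I \<noteq> {}" and h [measurable]: "h \<in> borel_measurable P"
    and bnd: "\<And>y. y \<in> space P \<Longrightarrow> \<bar>h y\<bar> \<le> B" and B: "B > 0" and L: "L \<ge> 0"
  shows "measure (PiM I (\<lambda>_. P)) {x \<in> space (PiM I (\<lambda>_. P)).
      \<bar>mean_dev P I h x\<bar> \<ge> B / sqrt (real (card I)) * sqrt (2 * L)} \<le> 2 * exp (- L)"
proof -
  let ?M = "PiM I (\<lambda>_. P)" and ?t = "B / sqrt (real (card I)) * sqrt (2 * L)"
  have int: "integrable ?M (\<lambda>x. h (x i))" if "i \<in> I" for i
    using that bnd by (intro Pi.integrable_bounded[where K = B]) (auto simp: space_PiM)
  have "(\<integral>x. mean_dev P I h x \<partial>?M) = (1 / real (card I)) * (\<Sum>i\<in>I. \<integral>x. h (x i) \<partial>?M) - (\<integral>y. h y \<partial>P)"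
    unfolding mean_dev_def using int by (simp add: Pi.prob_space)
  also have "\<dots> = 0"
    using I by (simp add: integral_PiM_component)
  finally have E: "(\<integral>x. mean_dev P I h x \<partial>?M) = 0" .
  have "measure ?M {x \<in> space ?M. \<bar>mean_dev P I h x\<bar> \<ge> ?t}
      \<le> measure ?M ({x \<in> space ?M. mean_dev P I h x \<ge> ?t} \<union> {x \<in> space ?M. - mean_dev P I h x \<ge> ?t})"
    by (intro Pi.finite_measure_mono) auto
  also have "\<dots> \<le> measure ?M {x \<in> space ?M. mean_dev P I h x \<ge> ?t} + measure ?M {x \<in> space ?M. - mean_dev P I h x \<ge> ?t}"
    by (intro measure_Un_le) measurable
  also have "measure ?M {x \<in> space ?M. mean_dev P I h x \<ge> ?t} \<le> exp (- L)"
    using mean_dev_lipschitz_tail[OF I h, of B L "\<lambda>x. x"] bnd B L E by simp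
  also have "measure ?M {x \<in> space ?M. - mean_dev P I h x \<ge> ?t} \<le> exp (- L)"
    using mean_dev_lipschitz_tail[OF I h, of B L uminus] bnd B L E by simp
  finally show ?thesis by simp
qed

end

section \<open>Label shift\<close>

text \<open>As there are finitely many labels, a measurable set is a finite disjoint union of slices
  \<open>S j \<times> {j}\<close>, and on each slice label shift says that Q is the importance
  weight of j times P.\<close>

lemma label_shift_density:
  fixes P Q :: "('x \<times> 'k::finite) measure"
  assumes P_prob: "prob_space P" and Q_prob: "prob_space Q"
    and P_sets: "sets P = sets (M \<Otimes>\<^sub>M count_space UNIV)"
    and Q_sets: "sets Q = sets (M \<Otimes>\<^sub>M count_space UNIV)"
    and shift: "label_shift M P Q"
  shows "Q = density P (\<lambda>z. ennreal (label_prob Q (snd z) / label_prob P (snd z)))"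
proof (rule measure_eqI)
  interpret P: prob_space P by fact
  interpret Q: prob_space Q by fact
  define w where "w j = label_prob Q j / label_prob P j" for j
  have w: "w j \<ge> 0" for j by (simp add: w_def label_prob_def)
  show "sets Q = sets (density P (\<lambda>z. ennreal (label_prob Q (snd z) / label_prob P (snd z))))"
    by (simp add: P_sets Q_sets)
  fix A assume A: "A \<in> sets Q"
  define S where "S j = (\<lambda>x. (x, j)) -` A" for j
  have S: "S j \<in> sets M" for j
    unfolding S_def using A by (intro sets_Pair2[where ?M2.0 = "count_space UNIV"]) (simp add: Q_sets)
  have SP: "S j \<times> {j} \<in> sets P" "S j \<times> {j} \<in> sets Q" for j
    using S by (auto simp: P_sets Q_sets)
  have AS: "A = (\<Union>j. S j \<times> {j})"
    by (auto simp: S_def)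
  have [measurable]: "snd \<in> P \<rightarrow>\<^sub>M count_space UNIV"
    by (simp add: measurable_cong_sets[OF P_sets refl])
  have "emeasure Q A = (\<Sum>j\<in>UNIV. emeasure Q (S j \<times> {j}))"
    unfolding AS using SP by (intro sum_emeasure[symmetric]) (auto simp: disjoint_family_on_def)
  also have "\<dots> = (\<Sum>j\<in>UNIV. ennreal (w j) * emeasure P (S j \<times> {j}))"
  proof (rule sum.cong[OF refl])
    fix j
    have "measure Q (S j \<times> {j}) = w j * measure P (S j \<times> {j})"
      using shift S[of j] by (simp add: label_shift_def w_def)
    then show "emeasure Q (S j \<times> {j}) = ennreal (w j) * emeasure P (S j \<times> {j})"
      using w by (simp add: P.emeasure_eq_measure Q.emeasure_eq_measure ennreal_mult)
  qed
  also have "\<dots> = (\<integral>\<^sup>+z. (\<Sum>j\<in>UNIV. ennreal (w j) * indicator (S j \<times> {j}) z) \<partial>P)"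
    using SP by (subst nn_integral_sum) (auto simp: nn_integral_cmult_indicator)
  also have "\<dots> = (\<integral>\<^sup>+z. ennreal (w (snd z)) * indicator A z \<partial>P)"
  proof (rule nn_integral_cong)
    fix z :: "'x \<times> 'k"
    have "(\<Sum>j\<in>UNIV. ennreal (w j) * indicator (S j \<times> {j}) z)
        = (\<Sum>j\<in>UNIV. if j = snd z then ennreal (w (snd z)) * indicator A z else 0)"
      by (intro sum.cong refl, cases z) (auto simp: S_def indicator_def)
    then show "(\<Sum>j\<in>UNIV. ennreal (w j) * indicator (S j \<times> {j}) z) = ennreal (w (snd z)) * indicator A z"
      by simp
  qed
  also have "\<dots> = emeasure (density P (\<lambda>z. ennreal (w (snd z)))) A"
    using A by (intro emeasure_density[symmetric]) (auto simp: P_sets Q_sets)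
  finally show "emeasure Q A = emeasure (density P (\<lambda>z. ennreal (label_prob Q (snd z) / label_prob P (snd z)))) A"
    by (simp add: w_def)
qed

section \<open>Concentration of the estimators\<close>

definition mean_vec :: "'a measure \<Rightarrow> ('a \<Rightarrow> real^'d) \<Rightarrow> real^'d" where
  "mean_vec P h = (\<chi> i. \<integral>z. h z $ i \<partial>P)"

lemma borel_measurable_vec_nth_comp:
  fixes h :: "'a \<Rightarrow> real^'d"
  assumes "h \<in> borel_measurable P"
  shows "(\<lambda>z. h z $ i) \<in> borel_measurable P"
proof -
  have "(\<lambda>v::real^'d. v $ i) \<in> borel_measurable borel"
    by (intro borel_measurable_continuous_onI continuous_intros)
  with assms show ?thesis by measurable
qed

text \<open>The rank one matrix g(x) times the transpose of the basis vector of y. Its mean is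
  \<open>T_mat\<close> and its empirical mean is \<open>est_T\<close>.\<close>

definition joint_feature :: "('x \<Rightarrow> real^'d) \<Rightarrow> 'x \<times> 'k::finite \<Rightarrow> real^'k^'d" where
  "joint_feature g z = (\<chi> a b. g (fst z) $ a * (if snd z = b then 1 else 0))"

text \<open>Only the column of the observed label is nonzero. This keeps the number of labels out of
  the Frobenius bound on the deviation of \<open>est_T\<close>.\<close>

lemma norm_joint_feature: "norm (joint_feature g z) = norm (g (fst z))"
proof -
  have "joint_feature g z $ a = (g (fst z) $ a) *\<^sub>R axis (snd z) 1" for a
    by (simp add: joint_feature_def vec_eq_iff axis_def)
  then have "norm (joint_feature g z $ a) = norm (g (fst z) $ a)" for a
    by (simp add: norm_axis_1)
  then show ?thesis
    by (simp only: norm_vec_def)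
qed

lemma borel_measurable_joint_feature:
  fixes g :: "'x \<Rightarrow> real^'d" and P :: "('x \<times> 'k::finite) measure"
  assumes sets: "sets P = sets (M \<Otimes>\<^sub>M count_space UNIV)" and g: "g \<in> borel_measurable M"
  shows "joint_feature g \<in> borel_measurable P"
proof -
  have [measurable]: "(\<lambda>x. g x $ a) \<in> borel_measurable M" for a
    by (rule borel_measurable_vec_nth_comp[OF g])
  have "(\<lambda>z::'x \<times> 'k. g (fst z) $ a * (if snd z = b then 1 else 0))
      \<in> borel_measurable (M \<Otimes>\<^sub>M count_space UNIV)" for a b
    by measurable
  then have "(\<lambda>z. joint_feature g z \<bullet> u) \<in> borel_measurable P" if "u \<in> Basis" for u :: "real^'k^'d"
    using that unfolding measurable_cong_sets[OF sets refl]
    by (auto simp: Basis_vec_def inner_axis joint_feature_def)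
  then show ?thesis
    by (simp add: borel_measurable_euclidean_space[of "joint_feature g"])
qed

text \<open>Changing measure by the label weights w turns the mean of g under Q into T w, while the
  mean under P is T applied to the all-ones vector; the difference is T \<theta>.\<close>

lemma T_mat_mult_theta_vec:
  fixes P Q :: "('x \<times> 'k::finite) measure" and g :: "'x \<Rightarrow> real^'d::finite"
  assumes P_prob: "prob_space P" and Q_prob: "prob_space Q"
    and P_sets: "sets P = sets (M \<Otimes>\<^sub>M count_space UNIV)"
    and Q_sets: "sets Q = sets (M \<Otimes>\<^sub>M count_space UNIV)"
    and shift: "label_shift M P Q"
    and g: "g \<in> borel_measurable M"
    and g_bnd: "\<And>x i. x \<in> space M \<Longrightarrow> \<bar>g x $ i\<bar> \<le> 1"
  shows "T_mat P g *v theta_vec P Q = mean_vec Q (\<lambda>z. g (fst z)) - mean_vec P (\<lambda>z. g (fst z))"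
proof -
  interpret P: prob_space P by fact
  define w where "w j = label_prob Q j / label_prob P j" for j
  have w: "w j \<ge> 0" for j by (simp add: w_def label_prob_def)
  have sp: "space P = space M \<times> UNIV"
    using sets_eq_imp_space_eq[OF P_sets] by (simp add: space_pair_measure)
  have [measurable]: "fst \<in> P \<rightarrow>\<^sub>M M" "snd \<in> P \<rightarrow>\<^sub>M count_space UNIV"
    by (simp_all add: measurable_cong_sets[OF P_sets refl])
  have [measurable]: "(\<lambda>x. g x $ i) \<in> borel_measurable M" for i
    by (rule borel_measurable_vec_nth_comp[OF g])
  have int: "integrable P (\<lambda>z. g (fst z) $ i * (if snd z = j then 1 else 0))" for i j
    using g_bnd by (intro P.integrable_bounded[where K = 1]) (auto simp: sp)
  have split: "(\<integral>z. g (fst z) $ i * v (snd z) \<partial>P) = (\<Sum>j\<in>UNIV. T_mat P g $ i $ j * v j)"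
    for i and v :: "'k \<Rightarrow> real"
  proof -
    have "(\<integral>z. g (fst z) $ i * v (snd z) \<partial>P)
        = (\<integral>z. (\<Sum>j\<in>UNIV. g (fst z) $ i * (if snd z = j then 1 else 0) * v j) \<partial>P)"
      by (intro Bochner_Integration.integral_cong) (auto simp: if_distrib if_distribR cong: if_cong)
    also have "\<dots> = (\<Sum>j\<in>UNIV. (\<integral>z. g (fst z) $ i * (if snd z = j then 1 else 0) \<partial>P) * v j)"
      using int by (subst Bochner_Integration.integral_sum) auto
    finally show ?thesis by (simp add: T_mat_def)
  qed
  have "(T_mat P g *v theta_vec P Q) $ i
      = mean_vec Q (\<lambda>z. g (fst z)) $ i - mean_vec P (\<lambda>z. g (fst z)) $ i" for i
  proof -
    have "(\<integral>z. g (fst z) $ i \<partial>Q) = (\<integral>z. g (fst z) $ i \<partial>density P (\<lambda>z. ennreal (w (snd z))))"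
      using label_shift_density[OF P_prob Q_prob P_sets Q_sets shift] by (simp add: w_def)
    also have "\<dots> = (\<integral>z. w (snd z) *\<^sub>R (g (fst z) $ i) \<partial>P)"
      using w by (intro integral_density) auto
    also have "\<dots> = (\<Sum>j\<in>UNIV. T_mat P g $ i $ j * w j)"
      using split[of i w] by (simp add: mult.commute)
    finally have Q: "(\<integral>z. g (fst z) $ i \<partial>Q) = (\<Sum>j\<in>UNIV. T_mat P g $ i $ j * w j)" .
    have P: "(\<integral>z. g (fst z) $ i \<partial>P) = (\<Sum>j\<in>UNIV. T_mat P g $ i $ j)"
      using split[of i "\<lambda>_. 1"] by simp
    show ?thesis
      by (simp add: mean_vec_def P Q matrix_vector_mult_def theta_vec_def w_def
          right_diff_distrib sum_subtractf)
  qed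
  then show ?thesis by (simp add: vec_eq_iff)
qed

text \<open>Hoeffding in each coordinate with 2 exp (-L) = \<delta> / d, then a union bound over the
  d coordinates. The threshold of the scalar tail is the source of the factor sqrt 2.\<close>

lemma norm_mean_vec_concentration:
  fixes P :: "'a measure" and h :: "'a \<Rightarrow> real^'d"
  assumes prob: "prob_space P" and N: "N > 0" and h: "h \<in> borel_measurable P"
    and bnd: "\<And>z i. z \<in> space P \<Longrightarrow> \<bar>h z $ i\<bar> \<le> 1"
    and \<delta>: "0 < \<delta>" "\<delta> \<le> 1"
  defines "R \<equiv> PiM {..<N} (\<lambda>_. P)"
  shows "\<exists>E \<in> sets R. measure R (space R - E) \<le> \<delta> \<and>
    (\<forall>x\<in>E. norm ((1 / real N) *\<^sub>R (\<Sum>i<N. h (x i)) - mean_vec P h)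
       \<le> sqrt 2 * sqrt (real CARD('d) / real N * ln (2 * real CARD('d) / \<delta>)))"
proof -
  interpret R: prob_space R
    unfolding R_def by (intro prob_space_PiM prob)
  define d where "d = real CARD('d)"
  have d: "d \<ge> 1" by (simp add: d_def Suc_le_eq)
  define L where "L = ln (2 * d / \<delta>)"
  have L: "L \<ge> 0" "exp (- L) = \<delta> / (2 * d)"
    using d \<delta> by (simp_all add: L_def exp_minus)
  define t where "t = 1 / sqrt (real N) * sqrt (2 * L)"
  have t: "t \<ge> 0" using L by (simp add: t_def)
  have h_i [measurable]: "(\<lambda>z. h z $ i) \<in> borel_measurable P" for i
    by (rule borel_measurable_vec_nth_comp[OF h])
  define bad where "bad i = {x \<in> space R. \<bar>mean_dev P {..<N} (\<lambda>z. h z $ i) x\<bar> \<ge> t}" for i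
  have bad [measurable]: "bad i \<in> sets R" for i
    unfolding bad_def R_def by measurable
  define E where "E = space R - (\<Union>i. bad i)"
  have "measure R (\<Union>i. bad i) \<le> (\<Sum>i\<in>UNIV. measure R (bad i))"
    by (intro measure_UNION_le) auto
  also have "\<dots> \<le> (\<Sum>i\<in>(UNIV::'d set). 2 * exp (- L))"
  proof (rule sum_mono)
    fix i
    show "measure R (bad i) \<le> 2 * exp (- L)"
      using abs_mean_dev_tail[OF prob, of "{..<N}" "\<lambda>z. h z $ i" 1 L] N bnd L
      by (auto simp: bad_def R_def t_def)
  qed
  also have "\<dots> = \<delta>"
    using d by (simp add: L d_def)
  finally have "measure R (space R - E) \<le> \<delta>"
    by (simp add: E_def bad_def Diff_Diff_Int Int_absorb1 UN_least)
  moreover have "E \<in> sets R"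
    unfolding E_def by (intro sets.Diff sets.top sets.finite_UN) auto
  moreover have "norm ((1 / real N) *\<^sub>R (\<Sum>i<N. h (x i)) - mean_vec P h)
       \<le> sqrt 2 * sqrt (real CARD('d) / real N * ln (2 * real CARD('d) / \<delta>))" if x: "x \<in> E" for x
  proof -
    have "((1 / real N) *\<^sub>R (\<Sum>i<N. h (x i)) - mean_vec P h) $ i = mean_dev P {..<N} (\<lambda>z. h z $ i) x" for i
      by (simp add: mean_dev_def mean_vec_def)
    then have "norm ((1 / real N) *\<^sub>R (\<Sum>i<N. h (x i)) - mean_vec P h) \<le> sqrt d * t"
      unfolding d_def using x t by (intro norm_vec_le_sqrt_card) (auto simp: E_def bad_def not_le less_imp_le)
    also have "\<dots> = sqrt 2 * sqrt (d / real N * L)"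
      by (simp add: t_def real_sqrt_mult real_sqrt_divide)
    finally show ?thesis by (simp add: d_def L_def)
  qed
  ultimately show ?thesis by blast
qed

text \<open>The whole matrix is treated as one bounded random vector of norm at most sqrt d, with L
  = ln (1 / \<delta>), so no union over entries enters the logarithm.\<close>

lemma est_T_concentration:
  fixes P :: "('x \<times> 'k::finite) measure" and g :: "'x \<Rightarrow> real^'d::finite"
  assumes prob: "prob_space P" and sets: "sets P = sets (M \<Otimes>\<^sub>M count_space UNIV)"
    and g: "g \<in> borel_measurable M"
    and g_bnd: "\<And>x i. x \<in> space M \<Longrightarrow> \<bar>g x $ i\<bar> \<le> 1"
    and N: "N > 0" and \<delta>: "0 < \<delta>" "\<delta> \<le> 1"
  defines "R \<equiv> PiM {..<N} (\<lambda>_. P)"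
  shows "\<exists>E \<in> sets R. measure R (space R - E) \<le> \<delta> \<and>
    (\<forall>x\<in>E. norm (est_T N g x - T_mat P g)
       \<le> sqrt (real CARD('d) / real N) * (1 + sqrt (2 * ln (1 / \<delta>))))"
proof -
  interpret P: prob_space P by fact
  interpret R: prob_space R
    unfolding R_def by (intro prob_space_PiM prob)
  have sp: "space P = space M \<times> UNIV"
    using sets_eq_imp_space_eq[OF sets] by (simp add: space_pair_measure)
  have jf [measurable]: "joint_feature g \<in> borel_measurable P"
    by (rule borel_measurable_joint_feature[OF sets g])
  have bnd: "norm (joint_feature g z) \<le> sqrt (real CARD('d))" if "z \<in> space P" for z
    using norm_vec_le_sqrt_card[of 1 "g (fst z)"] g_bnd[of "fst z"] that
    by (auto simp: norm_joint_feature sp)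
  have int: "integrable P (joint_feature g)"
    by (rule P.integrable_bounded[OF jf bnd])
  have T: "T_mat P g = (\<integral>z. joint_feature g z \<partial>P)"
  proof -
    have "(\<integral>z. joint_feature g z \<partial>P) $ a $ b = (\<integral>z. joint_feature g z $ a $ b \<partial>P)" for a b
      using integral_bounded_linear[OF bounded_linear_compose[OF bounded_linear_vec_nth bounded_linear_vec_nth] int, of a b]
      by simp
    then show ?thesis
      by (simp add: vec_eq_iff T_mat_def joint_feature_def)
  qed
  have dev: "est_T N g x - T_mat P g = mean_dev P {..<N} (joint_feature g) x" for x
    by (simp add: T mean_dev_def vec_eq_iff est_T_def joint_feature_def)
  define r where "r = sqrt (real CARD('d)) / sqrt (real N) * (1 + sqrt (2 * ln (1 / \<delta>)))"
  define E where "E = {x \<in> space R. norm (est_T N g x - T_mat P g) < r}"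
  have E: "E \<in> sets R"
    unfolding E_def dev R_def by measurable
  have "space R - E = {x \<in> space R. norm (mean_dev P {..<N} (joint_feature g) x) \<ge> r}"
    by (auto simp: E_def dev)
  then have "measure R (space R - E) \<le> exp (- ln (1 / \<delta>))"
    using norm_mean_dev_tail[OF prob _ _ jf bnd, of "{..<N}" "ln (1 / \<delta>)"] N \<delta>
    by (auto simp: R_def r_def)
  also have "\<dots> = \<delta>"
    using \<delta> by (simp add: ln_div)
  finally have "measure R (space R - E) \<le> \<delta>" .
  moreover have "norm (est_T N g x - T_mat P g)
       \<le> sqrt (real CARD('d) / real N) * (1 + sqrt (2 * ln (1 / \<delta>)))" if "x \<in> E" for x
    using that by (simp add: E_def r_def real_sqrt_divide)
  ultimately show ?thesis
    using E by blast
qed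

text \<open>The margin is thin: with the cruder bound \<open>ln 4 \<ge> 4/3\<close> the inequality would fail.\<close>

lemma sqrt_concentration_margin:
  fixes y z :: real
  assumes y: "0 \<le> y" and z: "y + ln 4 \<le> z"
  shows "1 + sqrt (2 * y) \<le> (sqrt 32 - 4) * sqrt z"
proof -
  have "ln 4 = 2 * ln (2::real)"
    using ln_realpow[of 2 2] by simp
  moreover have "ln (2::real) \<ge> 27/40"
    using ln_approx_bounds[of 2 2, simplified, simplified eval_nat_numeral, simplified] by simp
  ultimately have ln4: "ln 4 \<ge> (27/20 :: real)" by simp
  have s32: "sqrt 32 = 4 * sqrt 2"
    using real_sqrt_mult[of 16 2] by simp
  \<comment> \<open>The upper bound gives 48 - 32 sqrt 2 \<ge> 2742/1000, used below; the lower
    bound keeps sqrt 32 - 4 nonnegative.\<close>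
  have s2: "sqrt 2 \<le> (14143/10000::real)" "sqrt 2 \<ge> (1414/1000::real)"
    by (rule real_le_lsqrt real_le_rsqrt; simp add: power2_eq_square)+
  have sq: "(sqrt 32 - 4)\<^sup>2 = 48 - 32 * sqrt 2"
    by (simp add: s32 power2_eq_square algebra_simps)
  have "(1 + sqrt (2 * y))\<^sup>2 = 1 + 2 * sqrt (2 * y) + 2 * y"
    using y by (simp add: power2_eq_square algebra_simps)
  also have "\<dots> \<le> (48 - 32 * sqrt 2) * (y + 27/20)"
  proof -
    define u where "u = sqrt (2 * y)"
    have u: "y = u\<^sup>2 / 2" "u \<ge> 0" using y by (simp_all add: u_def)
    \<comment> \<open>The right side minus the left side of the next inequality is 0.371 u^2 - 2u +
      2.7017, and this completed square lies below it by about 0.006.\<close>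
    have "0 \<le> 371/1000 * (u - 1000/371)\<^sup>2" by simp
    then have "1 + 2 * u + u\<^sup>2 \<le> 2742/1000 * (u\<^sup>2/2 + 27/20)"
      by (simp add: power2_eq_square algebra_simps)
    also have "\<dots> \<le> (48 - 32 * sqrt 2) * (u\<^sup>2/2 + 27/20)"
      using s2 by (intro mult_right_mono) (auto simp: add_nonneg_nonneg)
    finally show ?thesis using u(2) by (simp add: u(1))
  qed
  also have "\<dots> \<le> (48 - 32 * sqrt 2) * z"
    using s2 z ln4 by (intro mult_left_mono) auto
  also have "\<dots> = ((sqrt 32 - 4) * sqrt z)\<^sup>2"
    using y z ln4 by (simp add: power_mult_distrib sq)
  finally show ?thesis
  proof (rule power2_le_imp_le)
    show "0 \<le> (sqrt 32 - 4) * sqrt z"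
      using s2 y z ln4 unfolding s32 by (intro mult_nonneg_nonneg) auto
  qed
qed

section \<open>Combination of the three concentration events\<close>

theorem theorem1:
  fixes M :: "'x measure" and P Q :: "('x \<times> 'k::finite) measure"
    and g :: "'x \<Rightarrow> real^'d::finite"
    and \<alpha> \<delta> \<theta>max :: real and n N m :: nat
  assumes P_prob: "prob_space P" and Q_prob: "prob_space Q"
    and P_sets: "sets P = sets (M \<Otimes>\<^sub>M count_space UNIV)"
    and Q_sets: "sets Q = sets (M \<Otimes>\<^sub>M count_space UNIV)"
    and P_pos: "\<forall>j. label_prob P j > 0"
    and shift: "label_shift M P Q"
    and g_meas: "g \<in> borel_measurable M"
    and g_bnd: "\<forall>x\<in>space M. \<forall>i. \<bar>g x $ i\<bar> \<le> 1"
    and alpha: "0 < \<alpha>" "\<alpha> \<le> 1"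
    and N_def: "real N = \<alpha> * real n" and N_pos: "N > 0"
    and m_pos: "m > 0"
    and full_rank: "rank (T_mat P g) = CARD('k)"
    and theta_max: "\<theta>max \<ge> norm (theta_vec P Q)"
    and delta: "0 < \<delta>" "\<delta> < 1"
    and n_large: "real n \<ge> 32 / \<alpha> * (spec_norm (pinv (T_mat P g)))\<^sup>2 * real CARD('d)
                       * ln (6 * real (CARD('d) + CARD('k)) / \<delta>)"
  shows "\<exists>E \<in> sets (sample_space M N m P Q).
           measure (sample_space M N m P Q) E \<ge> 1 - \<delta> \<and>
           (\<forall>(xs, xs') \<in> E.
              norm (est_theta N m g xs xs' - theta_vec P Q)
              \<le> 2 * spec_norm (pinv (T_mat P g)) *
                 (sqrt (real CARD('d) / (\<alpha> * real n) * ln (6 * real CARD('d) / \<delta>))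
                  + sqrt (real CARD('d) / real m * ln (6 * real CARD('d) / \<delta>))
                  + 2 * \<theta>max * sqrt (2 * real CARD('d) / (\<alpha> * real n)
                                        * ln (6 * real (CARD('d) + CARD('k)) / \<delta>))))"
proof -
  interpret P: prob_space P by fact
  interpret Q: prob_space Q by fact
  define R1 where "R1 = PiM {..<N} (\<lambda>_. P)"
  define D where "D = distr Q M fst"
  define R2 where "R2 = PiM {..<m} (\<lambda>_. D)"
  have spP: "space P = space M \<times> UNIV"
    using sets_eq_imp_space_eq[OF P_sets] by (simp add: space_pair_measure)
  have fst_meas [measurable]: "fst \<in> P \<rightarrow>\<^sub>M M" "fst \<in> Q \<rightarrow>\<^sub>M M"
    by (simp_all add: measurable_cong_sets[OF P_sets refl] measurable_cong_sets[OF Q_sets refl])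
  have D_prob: "prob_space D"
    unfolding D_def by (rule Q.prob_space_distr) simp
  interpret R1: prob_space R1
    unfolding R1_def by (intro prob_space_PiM P_prob)
  interpret R2: prob_space R2
    unfolding R2_def by (intro prob_space_PiM D_prob)
  have g_bnd': "\<And>x i. x \<in> space M \<Longrightarrow> \<bar>g x $ i\<bar> \<le> 1"
    using g_bnd by blast
  have gP: "(\<lambda>z. g (fst z)) \<in> borel_measurable P"
    using g_meas by measurable
  have gD: "g \<in> borel_measurable D"
    using g_meas by (simp add: D_def)
  have bndP: "\<bar>g (fst z) $ i\<bar> \<le> 1" if "z \<in> space P" for z i
    using that g_bnd' by (auto simp: spP)
  have bndD: "\<bar>g z $ i\<bar> \<le> 1" if "z \<in> space D" for z i
    using that g_bnd' by (simp add: D_def)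
  \<comment> \<open>A third of the failure probability goes to each of the three estimates; this
    turns 2d / (\<delta> / 3) into the 6d / \<delta> of the claim.\<close>
  have \<delta>3: "0 < \<delta> / 3" "\<delta> / 3 \<le> 1"
    using delta by auto
  obtain E1 where E1: "E1 \<in> sets R1" "measure R1 (space R1 - E1) \<le> \<delta> / 3"
    and p: "\<And>x. x \<in> E1 \<Longrightarrow> norm ((1 / real N) *\<^sub>R (\<Sum>i<N. g (fst (x i))) - mean_vec P (\<lambda>z. g (fst z)))
       \<le> sqrt 2 * sqrt (real CARD('d) / real N * ln (2 * real CARD('d) / (\<delta> / 3)))"
    using norm_mean_vec_concentration[OF P_prob N_pos gP bndP \<delta>3, folded R1_def] by blast
  obtain E2 where E2: "E2 \<in> sets R1" "measure R1 (space R1 - E2) \<le> \<delta> / 3"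
    and T: "\<And>x. x \<in> E2 \<Longrightarrow> norm (est_T N g x - T_mat P g)
       \<le> sqrt (real CARD('d) / real N) * (1 + sqrt (2 * ln (1 / (\<delta> / 3))))"
    using est_T_concentration[OF P_prob P_sets g_meas g_bnd' N_pos \<delta>3, folded R1_def] by blast
  obtain E3 where E3: "E3 \<in> sets R2" "measure R2 (space R2 - E3) \<le> \<delta> / 3"
    and q: "\<And>x. x \<in> E3 \<Longrightarrow> norm ((1 / real m) *\<^sub>R (\<Sum>i<m. g (x i)) - mean_vec D g)
       \<le> sqrt 2 * sqrt (real CARD('d) / real m * ln (2 * real CARD('d) / (\<delta> / 3)))"
    using norm_mean_vec_concentration[OF D_prob m_pos gD bndD \<delta>3, folded R2_def] by blast
  define E where "E = (E1 \<inter> E2) \<times> E3"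
  have sample: "sample_space M N m P Q = R1 \<Otimes>\<^sub>M R2"
    by (simp add: sample_space_def R1_def R2_def D_def)
  have E_sets: "E \<in> sets (sample_space M N m P Q)"
    unfolding sample E_def using E1 E2 E3 by auto
  have E_prob: "measure (sample_space M N m P Q) E \<ge> 1 - \<delta>"
  proof -
    \<comment> \<open>\<open>E1\<close> and \<open>E2\<close> concern the same sample, hence the
      union bound. \<open>E3\<close> concerns the independent one, so probabilities multiply, and
      the product of the two lower bounds exceeds 1 - \<delta> by 2 \<delta>^2 / 9.\<close>
    have "measure R1 (space R1 - E1 \<inter> E2) \<le> measure R1 (space R1 - E1) + measure R1 (space R1 - E2)"
      unfolding Diff_Int using E1 E2 by (intro measure_Un_le) auto
    then have "measure R1 (E1 \<inter> E2) \<ge> 1 - 2 * \<delta> / 3"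
      using R1.prob_compl[of "E1 \<inter> E2"] E1 E2 by simp
    moreover have "measure R2 E3 \<ge> 1 - \<delta> / 3"
      using R2.prob_compl[of E3] E3 by simp
    ultimately have "(1 - 2 * \<delta> / 3) * (1 - \<delta> / 3) \<le> measure R1 (E1 \<inter> E2) * measure R2 E3"
      using delta by (intro mult_mono) auto
    moreover have "1 - \<delta> \<le> (1 - 2 * \<delta> / 3) * (1 - \<delta> / 3)"
      by (simp add: algebra_simps)
    moreover have "measure (R1 \<Otimes>\<^sub>M R2) E = measure R1 (E1 \<inter> E2) * measure R2 E3"
      unfolding E_def measure_def using E1 E2 E3
      by (subst R2.emeasure_pair_measure_Times) (auto simp: enn2real_mult)
    ultimately show ?thesis
      unfolding sample by linarith
  qed
  define \<tau> where "\<tau> = spec_norm (pinv (T_mat P g))"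
  define d where "d = real CARD('d)"
  define L where "L = ln (6 * d / \<delta>)"
  define L' where "L' = ln (6 * real (CARD('d) + CARD('k)) / \<delta>)"
  define s where "s = sqrt (d / real N * L')"
  define \<epsilon> where "\<epsilon> = sqrt (d / real N) * (1 + sqrt (2 * ln (3 / \<delta>)))"
  have d: "d \<ge> 1" and dk: "2 \<le> real (CARD('d) + CARD('k))"
    unfolding d_def using zero_less_card_finite[where 'a='d] zero_less_card_finite[where 'a='k] by linarith+
  have y: "ln (3 / \<delta>) \<ge> 0" "ln (3 / \<delta>) + ln 4 \<le> L'"
  proof -
    show "ln (3 / \<delta>) \<ge> 0" using delta by simp
    \<comment> \<open>Since d + k \<ge> 2, the argument of the logarithm in \<open>L'\<close> is at
      least 12 / \<delta>; this supplies the ln 4 required by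
      \<open>sqrt_concentration_margin\<close>.\<close>
    have "ln (3 / \<delta>) + ln 4 = ln (12 / \<delta>)"
      using delta by (simp add: ln_mult_pos[symmetric])
    also have "\<dots> \<le> L'"
      unfolding L'_def using delta dk by (intro ln_mono divide_right_mono) auto
    finally show "ln (3 / \<delta>) + ln 4 \<le> L'" .
  qed
  have "ln 4 > (0::real)" by simp
  with y have L'_pos: "L' > 0" by linarith
  have "\<epsilon> \<le> sqrt (d / real N) * ((sqrt 32 - 4) * sqrt L')"
    unfolding \<epsilon>_def using d by (intro mult_left_mono sqrt_concentration_margin y) auto
  also have "\<dots> = (sqrt 32 - 4) * s"
    unfolding s_def real_sqrt_mult by simp
  finally have \<epsilon>: "\<epsilon> \<le> (sqrt 32 - 4) * s" .
  have s: "s \<ge> 0" "s\<^sup>2 = d / real N * L'"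
    unfolding s_def using d L'_pos by auto
  have s32: "sqrt 32 = 4 * sqrt 2"
    using real_sqrt_mult[of 16 2] by simp
  have s2: "1 \<le> sqrt (2::real)" "sqrt 2 \<le> (2::real)"
    by (auto intro: real_le_lsqrt)
  have "0 \<le> \<tau>"
    unfolding \<tau>_def spec_norm_def by (intro onorm_pos_le matrix_vector_mul_bounded_linear)
  \<comment> \<open>The sample size condition, which in terms of \<open>s\<close> says that sqrt 32
    times \<tau> s is at most 1.\<close>
  have "32 * \<tau>\<^sup>2 * d * L' \<le> real N"
    using n_large alpha unfolding N_def \<tau>_def d_def L'_def by (simp add: field_simps)
  then have "(sqrt 32 * \<tau> * s)\<^sup>2 \<le> 1\<^sup>2"
    using N_pos by (simp add: power_mult_distrib s field_simps)
  then have ts: "sqrt 32 * \<tau> * s \<le> 1"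
    by (rule power2_le_imp_le) simp
  have close: "\<epsilon> * \<tau> \<le> 1 - 1 / sqrt 2"
  proof -
    \<comment> \<open>Here sqrt 32 - 4 = (1 - 1 / sqrt 2) sqrt 32, which is why the margin lemma
      carries this constant.\<close>
    have "\<epsilon> * \<tau> \<le> (1 - 1 / sqrt 2) * (sqrt 32 * \<tau> * s)"
      using mult_right_mono[OF \<epsilon> \<open>0 \<le> \<tau>\<close>] by (simp add: s32 algebra_simps)
    also have "\<dots> \<le> (1 - 1 / sqrt 2) * 1"
      using ts s2 by (intro mult_left_mono) auto
    finally show ?thesis by simp
  qed
  have mq: "mean_vec D g = mean_vec Q (\<lambda>z. g (fst z))"
    unfolding mean_vec_def D_def
    using borel_measurable_vec_nth_comp[OF g_meas] by (simp add: integral_distr)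
  note Tth = T_mat_mult_theta_vec[OF P_prob Q_prob P_sets Q_sets shift g_meas g_bnd']
  have "norm (est_theta N m g xs xs' - theta_vec P Q)
      \<le> 2 * \<tau> * (sqrt (d / real N * L) + sqrt (d / real m * L) + 2 * \<theta>max * sqrt (2 * d / real N * L'))"
    if "(xs, xs') \<in> E" for xs xs'
  proof -
    have x: "xs \<in> E1" "xs \<in> E2" "xs' \<in> E3"
      using that by (auto simp: E_def)
    have dT: "norm (est_T N g xs - T_mat P g) \<le> \<epsilon>"
      using T[OF x(2)] by (simp add: \<epsilon>_def d_def)
    have "norm (est_T N g xs - T_mat P g) * \<tau> \<le> \<epsilon> * \<tau>"
      by (rule mult_right_mono[OF dT \<open>0 \<le> \<tau>\<close>])
    also note close
    finally have "norm (est_theta N m g xs xs' - theta_vec P Q)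
        \<le> sqrt 2 * \<tau> * (norm (est_q m g xs' - est_p N g xs - T_mat P g *v theta_vec P Q)
             + norm (est_T N g xs - T_mat P g) * norm (theta_vec P Q))"
      unfolding est_theta_def \<tau>_def by (intro norm_pinv_solution_perturbation_le full_rank)
    also have "\<dots> \<le> sqrt 2 * \<tau> * ((sqrt 2 * sqrt (d / real m * L) + sqrt 2 * sqrt (d / real N * L))
             + 4 * s * \<theta>max)"
    proof (intro mult_left_mono add_mono mult_mono)
      have "est_q m g xs' - est_p N g xs - T_mat P g *v theta_vec P Q
          = (est_q m g xs' - mean_vec D g) - (est_p N g xs - mean_vec P (\<lambda>z. g (fst z)))"
        by (simp add: Tth mq)
      also have "norm \<dots> \<le> sqrt 2 * sqrt (d / real m * L) + sqrt 2 * sqrt (d / real N * L)"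
      proof (rule order_trans[OF norm_triangle_ineq4 add_mono])
        show "norm (est_q m g xs' - mean_vec D g) \<le> sqrt 2 * sqrt (d / real m * L)"
          using q[OF x(3)] by (simp add: est_q_def d_def L_def)
        show "norm (est_p N g xs - mean_vec P (\<lambda>z. g (fst z))) \<le> sqrt 2 * sqrt (d / real N * L)"
          using p[OF x(1)] by (simp add: est_p_def d_def L_def)
      qed
      finally show "norm (est_q m g xs' - est_p N g xs - T_mat P g *v theta_vec P Q)
          \<le> sqrt 2 * sqrt (d / real m * L) + sqrt 2 * sqrt (d / real N * L)" .
      \<comment> \<open>A crude bound suffices for this term: 4 s \<theta>max times sqrt 2 \<tau> is
        exactly the third term of the claim.\<close>
      have "(sqrt 32 - 4) * s \<le> 4 * s"
        using s2 s(1) by (intro mult_right_mono) (auto simp: s32)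
      with dT \<epsilon> show "norm (est_T N g xs - T_mat P g) \<le> 4 * s" by linarith
    qed (use \<open>0 \<le> \<tau>\<close> s theta_max in auto)
    also have "\<dots> = 2 * \<tau> * (sqrt (d / real N * L) + sqrt (d / real m * L) + 2 * \<theta>max * (sqrt 2 * s))"
    proof -
      \<comment> \<open>With r = sqrt 2, the factor from the perturbed pseudoinverse and the one
        from Hoeffding multiply to the 2 of the claim; in the last term the single r is absorbed
        into the root.\<close>
      have "r * \<tau> * (r * b + r * a + 4 * s * \<theta>max) = 2 * \<tau> * (a + b + 2 * \<theta>max * (r * s))"
        if r: "r * r = 2" for a b r :: real
      proof -
        have "r * \<tau> * (r * b + r * a + 4 * s * \<theta>max) = (r * r) * \<tau> * (a + b) + 4 * r * \<tau> * s * \<theta>max"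
          by (simp add: algebra_simps)
        also have "\<dots> = 2 * \<tau> * (a + b + 2 * \<theta>max * (r * s))"
          unfolding r by (simp add: algebra_simps)
        finally show ?thesis .
      qed
      from this[of "sqrt 2"] show ?thesis by simp
    qed
    also have "sqrt 2 * s = sqrt (2 * d / real N * L')"
      unfolding s_def real_sqrt_mult[symmetric] by simp
    finally show ?thesis .
  qed
  with E_sets E_prob show ?thesis
    unfolding N_def[symmetric] \<tau>_def d_def L_def L'_def by (intro bexI[of _ E]) auto
qed

end
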